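(* Let $(\Omega,\Sigma,\mu)$ be a positive, complete, $\sigma$-finite measure space, $(\Omega_\alpha)_{\alpha\in I}$ a countable measurable partition of $\Omega$, $\mathcal X=(X_\alpha)_{\alpha\in I}$ a family of non-trivial Banach ideal spaces, $X_\alpha$ over $(\Omega_\alpha,\Sigma_\alpha,\mu_\alpha)$, and $E$ a Banach ideal space over the counting measure space $(I,2^I,m)$. Assume that $E$ and every $X_\alpha$ have the Fatou property, and that $E$, $E^*$ and every $X_\alpha$ are order continuous. Then the Köthe-Herz space $\left(E(\mathcal X),\|\cdot\|_{E(\mathcal X)}\right)$ is a Banach function space if and only if for every $A\in\Sigma$ with $\mu(A)<\infty$ the following two conditions hold: (a) $\left\|\left(\|\chi_{\Omega_\alpha\cap A}\|_{X_\alpha}\right)_\alpha\right\|_E<\infty$; (b) $\left\|\left(\|\chi_{\Omega_\alpha\cap A}\|_{X'_\alpha}\right)_\alpha\right\|_{E'}<\infty$, where $X'_\alpha$ and $E'$ are the Köthe duals of $X_\alpha$ and $E$, respectively.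
   Context: A Banach ideal space over $(\Omega,\Sigma,\mu)$ is a linear subspace $X$ of $L^0(\Omega,\Sigma,\mu)$ (classes of real measurable functions) with a complete norm such that (i) if $f\in L^0$, $g\in X$, $|f|\le|g|$ a.e., then $f\in X$ and $\|f\|_X\le\|g\|_X$; (ii) there is $f\in X$ strictly positive on the whole of $\Omega$. Its Köthe dual is $X'=\{g\in L^0:\|g\|_{X'}=\sup_{\|f\|_X\le1}\int|fg|\,d\mu<\infty\}$; $X^*$ is the topological dual. Norms are taken to be $+\infty$ outside the space. Order continuity of a normed lattice $F$: $\|f_n\|_F\to0$ for each sequence in $F$ with $f_n\ge f_{n+1}$, $\inf_nf_n=0$. Fatou property of $X$: if $f\in L^0$, $0\le f_n\in X$, $f_n\uparrow|f|$ a.e., $\sup_n\|f_n\|_X<\infty$, then $f\in X$ and $\lim_n\|f_n\|_X=\|f\|_X$. Measurable partition: $\Omega_\alpha\in\Sigma$, $\Omega=\bigcup_{\alpha}\Omega_\alpha$ $\mu$-a.e., $\mu(\Omega_\alpha\cap\Omega_\beta)=0$ for $\alpha\ne\beta$; $\Sigma_\alpha=\{\Omega_\alpha\cap B:B\in\Sigma\}$, $\mu_\alpha=\mu|_{\Sigma_\alpha}$. Köthe-Herz space: $E(\mathcal X)=\{f\in L^0(\Omega,\Sigma,\mu): f\chi_{\Omega_\alpha}\in X_\alpha\ \forall\alpha,\ (\|f\chi_{\Omega_\alpha}\|_{X_\alpha})_\alpha\in E\}$, $\|f\|_{E(\mathcal X)}=\left\|(\|f\chi_{\Omega_\alpha}\|_{X_\alpha})_\alpha\right\|_E$.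 Banach function space: a map $\eta:L^0_+\to[0,\infty]$ is a function norm if for all $f,g,f_n\in L^0_+$ and measurable $B\subseteq\Omega$: (P1) $\eta(f)=0$ iff $f=0$ a.e., $\eta(cf)=c\,\eta(f)$ for $c\ge0$, $\eta(f+g)\le\eta(f)+\eta(g)$; (P2) $0\le f\le g$ a.e. implies $\eta(f)\le\eta(g)$; (P3) $0\le f_n\uparrow f$ a.e. implies $\eta(f_n)\uparrow\eta(f)$; (P4) $\mu(B)<\infty$ implies $\eta(\chi_B)<\infty$; (P5) $\mu(B)<\infty$ implies $\int_Bf\,d\mu\le C_B\eta(f)$ with a finite constant $C_B>0$ independent of $f$. A Banach function space is $\{f\in L^0:\eta(|f|)<\infty\}$ with norm $\eta(|f|)$ for a function norm $\eta$; here $\eta=\|\cdot\|_{E(\mathcal X)}$. *)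

theory Defs
  imports "HOL-Analysis.Analysis"
begin

text \<open>
  A class in \<open>L\<^sup>0(M)\<close> is represented by any real function in \<open>borel_measurable M\<close>.
  A normed space \<open>X \<subseteq> L\<^sup>0(M)\<close> is represented by its norm alone, extended by \<open>\<infinity>\<close> outside
  the space, that is by \<open>N :: ('a \<Rightarrow> real) \<Rightarrow> ennreal\<close>; the set of its elements is
  \<open>ideal_carrier M N\<close>. The values of \<open>N\<close> on non-measurable functions are never used.
\<close>

definition ideal_carrier :: "'a measure \<Rightarrow> (('a \<Rightarrow> real) \<Rightarrow> ennreal) \<Rightarrow> ('a \<Rightarrow> real) set" where
  "ideal_carrier M N = {f \<in> borel_measurable M. N f < \<infinity>}"

text \<open>
  Well-definedness of the norm on classes is a consequence of the ideal property below.
\<close>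

definition banach_ideal_space :: "'a measure \<Rightarrow> (('a \<Rightarrow> real) \<Rightarrow> ennreal) \<Rightarrow> bool" where
  "banach_ideal_space M N \<longleftrightarrow>
     (\<lambda>x. 0) \<in> ideal_carrier M N \<and>
     (\<forall>f \<in> ideal_carrier M N. \<forall>g \<in> ideal_carrier M N. (\<lambda>x. f x + g x) \<in> ideal_carrier M N) \<and>
     (\<forall>f \<in> ideal_carrier M N. \<forall>c::real. (\<lambda>x. c * f x) \<in> ideal_carrier M N) \<and>
     (\<forall>f \<in> ideal_carrier M N. N f = 0 \<longleftrightarrow> (AE x in M. f x = 0)) \<and>
     (\<forall>f \<in> ideal_carrier M N. \<forall>c::real. N (\<lambda>x. c * f x) = ennreal \<bar>c\<bar> * N f) \<and>
     (\<forall>f \<in> ideal_carrier M N. \<forall>g \<in> ideal_carrier M N. N (\<lambda>x. f x + g x) \<le> N f + N g) \<and>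
     (\<forall>u :: nat \<Rightarrow> 'a \<Rightarrow> real.
        (\<forall>n. u n \<in> ideal_carrier M N) \<and>
        (\<forall>e>0. \<exists>K. \<forall>m\<ge>K. \<forall>n\<ge>K. N (\<lambda>x. u m x - u n x) < e) \<longrightarrow>
        (\<exists>f \<in> ideal_carrier M N. (\<lambda>n. N (\<lambda>x. u n x - f x)) \<longlonglongrightarrow> 0)) \<and>
     (\<forall>f \<in> borel_measurable M. \<forall>g \<in> ideal_carrier M N.
        (AE x in M. \<bar>f x\<bar> \<le> \<bar>g x\<bar>) \<longrightarrow> f \<in> ideal_carrier M N \<and> N f \<le> N g) \<and>
     (\<exists>f \<in> ideal_carrier M N. \<forall>x \<in> space M. 0 < f x)"

definition nontrivial_space :: "'a measure \<Rightarrow> (('a \<Rightarrow> real) \<Rightarrow> ennreal) \<Rightarrow> bool" where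
  "nontrivial_space M N \<longleftrightarrow> (\<exists>f \<in> ideal_carrier M N. \<not> (AE x in M. f x = 0))"

definition fatou_property :: "'a measure \<Rightarrow> (('a \<Rightarrow> real) \<Rightarrow> ennreal) \<Rightarrow> bool" where
  "fatou_property M N \<longleftrightarrow>
     (\<forall>f \<in> borel_measurable M. \<forall>u :: nat \<Rightarrow> 'a \<Rightarrow> real.
        (\<forall>n. u n \<in> ideal_carrier M N \<and> (AE x in M. 0 \<le> u n x)) \<and>
        (AE x in M. incseq (\<lambda>n. u n x) \<and> (\<lambda>n. u n x) \<longlonglongrightarrow> \<bar>f x\<bar>) \<and>
        (SUP n. N (u n)) < \<infinity> \<longrightarrow>
        f \<in> ideal_carrier M N \<and> (\<lambda>n. N (u n)) \<longlonglongrightarrow> N f)"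

text \<open>
  Order continuity of the norm \<open>nrm\<close> of a normed lattice with carrier \<open>F\<close>, order \<open>le\<close> and
  zero element \<open>z\<close>. The relation \<open>le\<close> may be a preorder on representatives; the infimum of the
  sequence is the one of the lattice \<open>F\<close>, so the last two hypotheses say that \<open>z\<close> is the
  greatest lower bound in \<open>F\<close>.
\<close>

definition order_continuous ::
  "'v set \<Rightarrow> ('v \<Rightarrow> 'v \<Rightarrow> bool) \<Rightarrow> 'v \<Rightarrow> ('v \<Rightarrow> ennreal) \<Rightarrow> bool" where
  "order_continuous F le z nrm \<longleftrightarrow>
     (\<forall>u :: nat \<Rightarrow> 'v.
        (\<forall>n. u n \<in> F) \<and> (\<forall>n. le (u (Suc n)) (u n)) \<and>
        (\<forall>n. le z (u n)) \<and> (\<forall>v \<in> F. (\<forall>n. le v (u n)) \<longrightarrow> le v z) \<longrightarrow>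
        (\<lambda>n. nrm (u n)) \<longlonglongrightarrow> 0)"

definition order_continuous_space :: "'a measure \<Rightarrow> (('a \<Rightarrow> real) \<Rightarrow> ennreal) \<Rightarrow> bool" where
  "order_continuous_space M N \<longleftrightarrow>
     order_continuous (ideal_carrier M N) (\<lambda>f g. AE x in M. f x \<le> g x) (\<lambda>x. 0) N"

text \<open>
  The topological dual. Only the values of a functional on \<open>ideal_carrier M N\<close> matter, so two
  functionals agreeing there represent the same element of the dual.
\<close>

definition dual_carrier ::
  "'a measure \<Rightarrow> (('a \<Rightarrow> real) \<Rightarrow> ennreal) \<Rightarrow> (('a \<Rightarrow> real) \<Rightarrow> real) set" where
  "dual_carrier M N =
     {\<phi>. (\<forall>f \<in> ideal_carrier M N. \<forall>g \<in> ideal_carrier M N. \<phi> (\<lambda>x. f x + g x) = \<phi> f + \<phi> g) \<and>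
         (\<forall>f \<in> ideal_carrier M N. \<forall>c::real. \<phi> (\<lambda>x. c * f x) = c * \<phi> f) \<and>
         (\<exists>C::real. \<forall>f \<in> ideal_carrier M N. ennreal \<bar>\<phi> f\<bar> \<le> ennreal C * N f)}"

definition dual_le ::
  "'a measure \<Rightarrow> (('a \<Rightarrow> real) \<Rightarrow> ennreal) \<Rightarrow>
    (('a \<Rightarrow> real) \<Rightarrow> real) \<Rightarrow> (('a \<Rightarrow> real) \<Rightarrow> real) \<Rightarrow> bool" where
  "dual_le M N \<phi> \<psi> \<longleftrightarrow>
     (\<forall>f \<in> ideal_carrier M N. (AE x in M. 0 \<le> f x) \<longrightarrow> \<phi> f \<le> \<psi> f)"

definition dual_norm ::
  "'a measure \<Rightarrow> (('a \<Rightarrow> real) \<Rightarrow> ennreal) \<Rightarrow> (('a \<Rightarrow> real) \<Rightarrow> real) \<Rightarrow> ennreal" where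
  "dual_norm M N \<phi> = (SUP f \<in> {f \<in> ideal_carrier M N. N f \<le> 1}. ennreal \<bar>\<phi> f\<bar>)"

definition order_continuous_dual :: "'a measure \<Rightarrow> (('a \<Rightarrow> real) \<Rightarrow> ennreal) \<Rightarrow> bool" where
  "order_continuous_dual M N \<longleftrightarrow>
     order_continuous (dual_carrier M N) (dual_le M N) (\<lambda>f. 0) (dual_norm M N)"

definition koethe_dual_norm ::
  "'a measure \<Rightarrow> (('a \<Rightarrow> real) \<Rightarrow> ennreal) \<Rightarrow> ('a \<Rightarrow> real) \<Rightarrow> ennreal" where
  "koethe_dual_norm M N g =
     (if g \<in> borel_measurable M
      then (SUP f \<in> {f \<in> ideal_carrier M N. N f \<le> 1}. \<integral>\<^sup>+ x. ennreal \<bar>f x * g x\<bar> \<partial>M)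
      else \<infinity>)"

definition measurable_partition :: "'a measure \<Rightarrow> 'i set \<Rightarrow> ('i \<Rightarrow> 'a set) \<Rightarrow> bool" where
  "measurable_partition M I \<Omega> \<longleftrightarrow>
     (\<forall>\<alpha> \<in> I. \<Omega> \<alpha> \<in> sets M) \<and>
     (AE x in M. x \<in> (\<Union>\<alpha> \<in> I. \<Omega> \<alpha>)) \<and>
     (\<forall>\<alpha> \<in> I. \<forall>\<beta> \<in> I. \<alpha> \<noteq> \<beta> \<longrightarrow> emeasure M (\<Omega> \<alpha> \<inter> \<Omega> \<beta>) = 0)"

text \<open>
  Norm in \<open>E\<close> of a family with values in \<open>[0,\<infinity>]\<close>: a family with an infinite entry is not in \<open>E\<close>.
\<close>

definition family_norm :: "'i set \<Rightarrow> (('i \<Rightarrow> real) \<Rightarrow> ennreal) \<Rightarrow> ('i \<Rightarrow> ennreal) \<Rightarrow> ennreal" where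
  "family_norm I E a = (if \<forall>\<alpha> \<in> I. a \<alpha> < \<infinity> then E (\<lambda>\<alpha>. enn2real (a \<alpha>)) else \<infinity>)"

text \<open>
  The space over \<open>(\<Omega>\<^sub>\<alpha>, \<Sigma>\<^sub>\<alpha>, \<mu>\<^sub>\<alpha>)\<close> is a space over \<open>restrict_space M (\<Omega> \<alpha>)\<close>; functions
  there are total on the ambient type, but their values outside \<open>\<Omega> \<alpha>\<close> are irrelevant.
\<close>

definition koethe_herz_space ::
  "'a measure \<Rightarrow> 'i set \<Rightarrow> ('i \<Rightarrow> 'a set) \<Rightarrow> ('i \<Rightarrow> ('a \<Rightarrow> real) \<Rightarrow> ennreal) \<Rightarrow>
    (('i \<Rightarrow> real) \<Rightarrow> ennreal) \<Rightarrow> ('a \<Rightarrow> real) set" where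
  "koethe_herz_space M I \<Omega> X E =
     {f \<in> borel_measurable M.
        (\<forall>\<alpha> \<in> I. (\<lambda>x. f x * indicator (\<Omega> \<alpha>) x) \<in> ideal_carrier (restrict_space M (\<Omega> \<alpha>)) (X \<alpha>)) \<and>
        (\<lambda>\<alpha>. enn2real (X \<alpha> (\<lambda>x. f x * indicator (\<Omega> \<alpha>) x))) \<in> ideal_carrier (count_space I) E}"

definition koethe_herz_norm ::
  "'a measure \<Rightarrow> 'i set \<Rightarrow> ('i \<Rightarrow> 'a set) \<Rightarrow> ('i \<Rightarrow> ('a \<Rightarrow> real) \<Rightarrow> ennreal) \<Rightarrow>
    (('i \<Rightarrow> real) \<Rightarrow> ennreal) \<Rightarrow> ('a \<Rightarrow> real) \<Rightarrow> ennreal" where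
  "koethe_herz_norm M I \<Omega> X E f =
     (if f \<in> koethe_herz_space M I \<Omega> X E
      then family_norm I E (\<lambda>\<alpha>. X \<alpha> (\<lambda>x. f x * indicator (\<Omega> \<alpha>) x))
      else \<infinity>)"

definition L0_nonneg :: "'a measure \<Rightarrow> ('a \<Rightarrow> real) set" where
  "L0_nonneg M = {f \<in> borel_measurable M. AE x in M. 0 \<le> f x}"

definition function_norm :: "'a measure \<Rightarrow> (('a \<Rightarrow> real) \<Rightarrow> ennreal) \<Rightarrow> bool" where
  "function_norm M \<eta> \<longleftrightarrow>
     (\<forall>f \<in> L0_nonneg M. \<eta> f = 0 \<longleftrightarrow> (AE x in M. f x = 0)) \<and>
     (\<forall>f \<in> L0_nonneg M. \<forall>c::real. 0 \<le> c \<longrightarrow> \<eta> (\<lambda>x. c * f x) = ennreal c * \<eta> f) \<and>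
     (\<forall>f \<in> L0_nonneg M. \<forall>g \<in> L0_nonneg M. \<eta> (\<lambda>x. f x + g x) \<le> \<eta> f + \<eta> g) \<and>
     (\<forall>f \<in> L0_nonneg M. \<forall>g \<in> L0_nonneg M. (AE x in M. f x \<le> g x) \<longrightarrow> \<eta> f \<le> \<eta> g) \<and>
     (\<forall>f \<in> L0_nonneg M. \<forall>u :: nat \<Rightarrow> 'a \<Rightarrow> real.
        (\<forall>n. u n \<in> L0_nonneg M) \<and>
        (AE x in M. incseq (\<lambda>n. u n x) \<and> (\<lambda>n. u n x) \<longlonglongrightarrow> f x) \<longrightarrow>
        incseq (\<lambda>n. \<eta> (u n)) \<and> (\<lambda>n. \<eta> (u n)) \<longlonglongrightarrow> \<eta> f) \<and>
     (\<forall>B \<in> sets M. emeasure M B < \<infinity> \<longrightarrow> \<eta> (indicator B) < \<infinity>) \<and>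
     (\<forall>B \<in> sets M. emeasure M B < \<infinity> \<longrightarrow>
        (\<exists>C::real. 0 < C \<and>
          (\<forall>f \<in> L0_nonneg M. (\<integral>\<^sup>+ x \<in> B. ennreal (f x) \<partial>M) \<le> ennreal C * \<eta> f)))"

text \<open>
  The space \<open>S\<close> with norm \<open>nrm\<close> (extended by \<open>\<infinity>\<close> outside \<open>S\<close>) is the Banach function space of
  the function norm \<open>\<eta> = nrm\<close>.
\<close>

definition banach_function_space ::
  "'a measure \<Rightarrow> ('a \<Rightarrow> real) set \<Rightarrow> (('a \<Rightarrow> real) \<Rightarrow> ennreal) \<Rightarrow> bool" where
  "banach_function_space M S nrm \<longleftrightarrow>
     function_norm M nrm \<and>
     S = {f \<in> borel_measurable M. nrm (\<lambda>x. \<bar>f x\<bar>) < \<infinity>} \<and>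
     (\<forall>f \<in> S. nrm f = nrm (\<lambda>x. \<bar>f x\<bar>))"

end

theory Submission
  imports Defs
begin

text \<open>
  Write \<open>\<eta>\<close> for the Koethe-Herz norm and \<open>a\<^sub>\<alpha>(f)\<close> for the norm of \<open>f\<close> on the block \<open>\<Omega>\<^sub>\<alpha>\<close>, so that
  \<open>\<eta> f\<close> is the norm of the family \<open>a(f)\<close> in \<open>E\<close>. The axioms of a function norm fall into two groups.

  Definiteness, homogeneity, the triangle inequality, monotonicity and monotone continuity hold for
  every block and for \<open>E\<close>, the last one by the Fatou property, and they pass to the composition
  \<open>\<eta>\<close>. The only delicate point is monotone continuity in \<open>E\<close>: a bound on the norms of an increasing
  sequence of families must first force each coordinate to stay finite (\<open>family_norm_SUP\<close>), which it
  does because every unit vector has positive norm. What remains of being a Banach function space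
  (\<open>banach_function_space_iff\<close>) is, for each \<open>B\<close> of finite measure, that \<open>\<eta> (\<chi>\<^sub>B)\<close> is finite and
  that the integral over \<open>B\<close> is bounded by a multiple of \<open>\<eta>\<close>. The former is condition (a) verbatim.

  The latter says that \<open>\<chi>\<^sub>B\<close> lies in the Koethe dual of \<open>E(X)\<close>, and (b) says that it lies in
  \<open>E'(X')\<close>; the proof compares these two spaces (\<open>local_integral_bound_iff\<close>). If (b) holds, the
  Hoelder inequality on each block followed by the one in \<open>E\<close> bounds the integral
  (\<open>integral_le_dual_norm\<close>). Conversely, suppose that the integral over \<open>B\<close> is at most \<open>C\<close> times
  \<open>\<eta>\<close>. Testing with functions living on one block shows that the norm \<open>b\<^sub>\<alpha>\<close> in
  \<open>X\<^sub>\<alpha>'\<close> of the indicator of \<open>\<Omega>\<^sub>\<alpha> \<inter> B\<close> is finite. Hence some \<open>g\<^sub>\<alpha>\<close> in the unit ball of \<open>X\<^sub>\<alpha>\<close>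
  integrates over \<open>\<Omega>\<^sub>\<alpha> \<inter> B\<close> to at least half of \<open>b\<^sub>\<alpha>\<close>. For \<open>a\<close> in the unit ball of \<open>E\<close>, gluing
  the finitely many pieces \<open>\<bar>a\<^sub>\<alpha>\<bar> \<bar>g\<^sub>\<alpha>\<bar>\<close>, \<open>\<alpha> \<in> F\<close>, gives a function with \<open>\<eta>\<close> at most \<open>1\<close>, so that
  the sum of \<open>\<bar>a\<^sub>\<alpha>\<bar> b\<^sub>\<alpha>\<close> over \<open>F\<close> is at most \<open>2 C\<close>. Since \<open>F\<close> is arbitrary, the norm of \<open>b\<close> in
  \<open>E'\<close> is at most \<open>2 C\<close> (\<open>dual_herz_norm_finite\<close>).
\<close>

section \<open>Extended norms of Banach ideal spaces\<close>

text \<open>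
  The axioms of a Banach ideal space speak about its elements only. The lemmas below extend them to
  all measurable functions, the value \<open>\<infinity>\<close> included; most of the later estimates then need no
  membership side conditions.
\<close>

lemma ideal_carrier_iff:
  "f \<in> ideal_carrier M N \<longleftrightarrow> f \<in> borel_measurable M \<and> N f < \<infinity>"
  by (simp add: ideal_carrier_def)

lemma ideal_norm_mono:
  assumes "banach_ideal_space M N" "f \<in> borel_measurable M" "g \<in> borel_measurable M"
    and "AE x in M. \<bar>f x\<bar> \<le> \<bar>g x\<bar>"
  shows "N f \<le> N g"
proof (cases "N g < \<infinity>")
  case True
  then have "g \<in> ideal_carrier M N"
    using assms(3) by (simp add: ideal_carrier_iff)
  then show ?thesis
    using assms(1,2,4) unfolding banach_ideal_space_def by blast
next
  case False
  then show ?thesis by (simp add: less_top[symmetric])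
qed

lemma ideal_norm_cong:
  assumes "banach_ideal_space M N" "f \<in> borel_measurable M" "g \<in> borel_measurable M"
    and "AE x in M. \<bar>f x\<bar> = \<bar>g x\<bar>"
  shows "N f = N g"
proof (rule antisym)
  show "N f \<le> N g"
    by (rule ideal_norm_mono[OF assms(1-3)]) (use assms(4) in auto)
  show "N g \<le> N f"
    by (rule ideal_norm_mono[OF assms(1,3,2)]) (use assms(4) in auto)
qed

lemma ideal_norm_zero:
  assumes "banach_ideal_space M N"
  shows "N (\<lambda>x. 0) = 0"
proof -
  have "(\<lambda>x. 0) \<in> ideal_carrier M N" "\<forall>f \<in> ideal_carrier M N. N f = 0 \<longleftrightarrow> (AE x in M. f x = 0)"
    using assms unfolding banach_ideal_space_def by blast+
  then show ?thesis by auto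
qed

lemma ideal_norm_eq_0_iff:
  assumes "banach_ideal_space M N" "f \<in> borel_measurable M"
  shows "N f = 0 \<longleftrightarrow> (AE x in M. f x = 0)"
proof
  assume "N f = 0"
  then have "f \<in> ideal_carrier M N"
    using assms(2) by (simp add: ideal_carrier_iff)
  then show "AE x in M. f x = 0"
    using assms(1) \<open>N f = 0\<close> unfolding banach_ideal_space_def by blast
next
  assume "AE x in M. f x = 0"
  then have "N f = N (\<lambda>x. 0)"
    by (intro ideal_norm_cong[OF assms]) auto
  then show "N f = 0"
    using ideal_norm_zero[OF assms(1)] by simp
qed

lemma ideal_norm_scale:
  fixes c :: real
  assumes "banach_ideal_space M N" "f \<in> borel_measurable M"
  shows "N (\<lambda>x. c * f x) = ennreal \<bar>c\<bar> * N f"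
proof -
  have *: "N (\<lambda>x. c * f x) = ennreal \<bar>c\<bar> * N f" if "f \<in> ideal_carrier M N" for c f
    using assms(1) that unfolding banach_ideal_space_def by blast
  show ?thesis
  proof (cases "N f < \<infinity>")
    case True
    then show ?thesis using * assms(2) by (simp add: ideal_carrier_iff)
  next
    case False
    show ?thesis
    proof (cases "c = 0")
      case True
      then show ?thesis using ideal_norm_zero[OF assms(1)] by simp
    next
      case c: False
      \<comment> \<open>Otherwise \<open>f\<close>, being a multiple of \<open>c f\<close>, would have finite norm as well.\<close>
      have "N (\<lambda>x. c * f x) = \<infinity>"
      proof (rule ccontr)
        assume "N (\<lambda>x. c * f x) \<noteq> \<infinity>"
        then have c_carrier: "(\<lambda>x. c * f x) \<in> ideal_carrier M N"
          using assms(2) by (simp add: ideal_carrier_iff less_top)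
        have "N (\<lambda>x. inverse c * (c * f x)) = ennreal \<bar>inverse c\<bar> * N (\<lambda>x. c * f x)"
          by (rule *[OF c_carrier])
        also have "\<dots> < \<infinity>"
          using c_carrier by (simp add: ideal_carrier_iff ennreal_mult_less_top)
        finally show False using False c by (simp add: mult.assoc[symmetric])
      qed
      then show ?thesis using False c by (simp add: ennreal_mult_top less_top[symmetric])
    qed
  qed
qed

lemma ideal_norm_triangle:
  assumes "banach_ideal_space M N" "f \<in> borel_measurable M" "g \<in> borel_measurable M"
  shows "N (\<lambda>x. f x + g x) \<le> N f + N g"
proof (cases "N f < \<infinity> \<and> N g < \<infinity>")
  case True
  then have "f \<in> ideal_carrier M N" "g \<in> ideal_carrier M N"
    using assms(2,3) by (simp_all add: ideal_carrier_iff)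
  then show ?thesis
    using assms(1) unfolding banach_ideal_space_def by blast
next
  case False
  then show ?thesis by (auto simp: less_top[symmetric])
qed

text \<open>
  When the norms stay bounded this is the Fatou property; when they do not, monotonicity alone makes
  the limit function have infinite norm.
\<close>

lemma ideal_norm_SUP:
  fixes u :: "nat \<Rightarrow> 'a \<Rightarrow> real"
  assumes N: "banach_ideal_space M N" "fatou_property M N"
    and f: "f \<in> borel_measurable M" and u: "\<And>n. u n \<in> borel_measurable M"
    and pos: "\<And>n. AE x in M. 0 \<le> u n x"
    and lim: "AE x in M. incseq (\<lambda>n. u n x) \<and> (\<lambda>n. u n x) \<longlonglongrightarrow> f x"
  shows "incseq (\<lambda>n. N (u n))" "(SUP n. N (u n)) = N f"
proof -
  have pos_all: "AE x in M. \<forall>n. 0 \<le> u n x"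
    using pos by (simp add: AE_all_countable)
  show inc: "incseq (\<lambda>n. N (u n))"
  proof (rule incseq_SucI)
    fix n
    show "N (u n) \<le> N (u (Suc n))"
    proof (rule ideal_norm_mono[OF N(1) u u])
      show "AE x in M. \<bar>u n x\<bar> \<le> \<bar>u (Suc n) x\<bar>"
        using pos_all lim by eventually_elim (auto dest: incseq_SucD)
    qed
  qed
  have le: "N (u n) \<le> N f" for n
  proof (rule ideal_norm_mono[OF N(1) u f])
    show "AE x in M. \<bar>u n x\<bar> \<le> \<bar>f x\<bar>"
      using pos_all lim
    proof eventually_elim
      case (elim x)
      then have "u n x \<le> f x" by (auto intro: incseq_le)
      with elim show ?case by (auto intro: order_trans)
    qed
  qed
  show "(SUP n. N (u n)) = N f"
  proof (cases "(SUP n. N (u n)) < \<infinity>")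
    case False
    then have "(SUP n. N (u n)) = \<infinity>" by (simp only: infinity_ennreal_def less_top[symmetric] not_not)
    moreover have "(SUP n. N (u n)) \<le> N f" using le by (rule SUP_least)
    ultimately show ?thesis by (metis infinity_ennreal_def top_unique)
  next
    case True
    have carrier: "u n \<in> ideal_carrier M N" for n
      using u True le_less_trans[OF SUP_upper[of n UNIV "\<lambda>n. N (u n)"] True]
      by (simp add: ideal_carrier_iff)
    have "AE x in M. incseq (\<lambda>n. u n x) \<and> (\<lambda>n. u n x) \<longlonglongrightarrow> \<bar>f x\<bar>"
      using pos_all lim
    proof eventually_elim
      case (elim x)
      then have "0 \<le> f x"
        by (auto intro: LIMSEQ_le_const)
      with elim show ?case by simp
    qed
    then have "(\<lambda>n. N (u n)) \<longlonglongrightarrow> N f"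
      using N(2) f carrier pos True unfolding fatou_property_def by blast
    with LIMSEQ_SUP[OF inc] show ?thesis by (rule LIMSEQ_unique)
  qed
qed

text \<open>
  The function \<open>f / N f\<close> is one of the competitors in the supremum that defines the dual norm.
\<close>

lemma koethe_dual_hoelder:
  assumes "banach_ideal_space M N" "f \<in> borel_measurable M" "g \<in> borel_measurable M" "N f < \<infinity>"
  shows "(\<integral>\<^sup>+ x. ennreal \<bar>f x * g x\<bar> \<partial>M) \<le> N f * koethe_dual_norm M N g"
proof (cases "N f = 0")
  case True
  then have "AE x in M. f x = 0"
    using ideal_norm_eq_0_iff[OF assms(1,2)] by simp
  then have "(\<integral>\<^sup>+ x. ennreal \<bar>f x * g x\<bar> \<partial>M) = (\<integral>\<^sup>+ x. 0 \<partial>M)"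
    by (intro nn_integral_cong_AE) auto
  then show ?thesis by simp
next
  case False
  define c where "c = enn2real (N f)"
  have c: "0 < c" "N f = ennreal c"
    using False assms(4) by (auto simp: c_def enn2real_positive_iff zero_less_iff_neq_zero)
  define h where "h x = (1 / c) * f x" for x
  have h: "h \<in> borel_measurable M" using assms(2) by (simp add: h_def[abs_def])
  have "N h = ennreal \<bar>1 / c\<bar> * N f"
    unfolding h_def by (rule ideal_norm_scale[OF assms(1,2)])
  also have "\<dots> = 1" using c by (simp add: ennreal_mult[symmetric])
  finally have "N h = 1" .
  then have "(\<integral>\<^sup>+ x. ennreal \<bar>h x * g x\<bar> \<partial>M) \<le> koethe_dual_norm M N g"
    using h assms(3) by (auto simp: koethe_dual_norm_def ideal_carrier_iff intro!: SUP_upper)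
  moreover have "(\<integral>\<^sup>+ x. ennreal \<bar>f x * g x\<bar> \<partial>M) = N f * (\<integral>\<^sup>+ x. ennreal \<bar>h x * g x\<bar> \<partial>M)"
  proof -
    have "(\<integral>\<^sup>+ x. ennreal \<bar>f x * g x\<bar> \<partial>M) = (\<integral>\<^sup>+ x. ennreal c * ennreal \<bar>h x * g x\<bar> \<partial>M)"
      using c(1) by (intro nn_integral_cong) (simp add: h_def abs_mult ennreal_mult[symmetric])
    also have "\<dots> = ennreal c * (\<integral>\<^sup>+ x. ennreal \<bar>h x * g x\<bar> \<partial>M)"
      using h assms(3) by (intro nn_integral_cmult) auto
    finally show ?thesis by (simp add: c(2))
  qed
  ultimately show ?thesis by (simp add: mult_left_mono)
qed

lemma koethe_dual_norm_leI:
  assumes "g \<in> borel_measurable M"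
    and "\<And>f. f \<in> borel_measurable M \<Longrightarrow> N f \<le> 1 \<Longrightarrow> (\<integral>\<^sup>+ x. ennreal \<bar>f x * g x\<bar> \<partial>M) \<le> K"
  shows "koethe_dual_norm M N g \<le> K"
  using assms by (auto simp: koethe_dual_norm_def ideal_carrier_iff intro!: SUP_least)

section \<open>Families over a counting measure\<close>

lemma family_norm_less_top_iff:
  "family_norm I E a < \<infinity> \<longleftrightarrow> (\<forall>\<alpha>\<in>I. a \<alpha> < \<infinity>) \<and> E (\<lambda>\<alpha>. enn2real (a \<alpha>)) < \<infinity>"
  by (simp add: family_norm_def)

lemma family_norm_ennreal:
  assumes "banach_ideal_space (count_space I) E"
  shows "family_norm I E (\<lambda>\<alpha>. ennreal \<bar>a \<alpha>\<bar>) = E a"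
  using ideal_norm_cong[OF assms, of "\<lambda>\<alpha>. \<bar>a \<alpha>\<bar>" a]
  by (simp add: family_norm_def AE_count_space)

lemma family_norm_mono:
  assumes "banach_ideal_space (count_space I) E" "\<And>\<alpha>. \<alpha> \<in> I \<Longrightarrow> a \<alpha> \<le> b \<alpha>"
  shows "family_norm I E a \<le> family_norm I E b"
proof (cases "\<forall>\<alpha>\<in>I. b \<alpha> < \<infinity>")
  case True
  then have "\<forall>\<alpha>\<in>I. a \<alpha> < \<infinity>" using assms(2) le_less_trans by blast
  moreover have "E (\<lambda>\<alpha>. enn2real (a \<alpha>)) \<le> E (\<lambda>\<alpha>. enn2real (b \<alpha>))"
    using True assms(2) by (intro ideal_norm_mono[OF assms(1)]) (auto simp: AE_count_space enn2real_mono)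
  ultimately show ?thesis using True by (simp add: family_norm_def)
qed (auto simp: family_norm_def)

lemma family_norm_cong:
  assumes "banach_ideal_space (count_space I) E" "\<And>\<alpha>. \<alpha> \<in> I \<Longrightarrow> a \<alpha> = b \<alpha>"
  shows "family_norm I E a = family_norm I E b"
  by (intro antisym family_norm_mono[OF assms(1)]) (simp_all add: assms(2))

lemma family_norm_eq_0_iff:
  assumes "banach_ideal_space (count_space I) E"
  shows "family_norm I E a = 0 \<longleftrightarrow> (\<forall>\<alpha>\<in>I. a \<alpha> = 0)"
proof -
  have "E (\<lambda>\<alpha>. enn2real (a \<alpha>)) = 0 \<longleftrightarrow> (\<forall>\<alpha>\<in>I. enn2real (a \<alpha>) = 0)"
    using ideal_norm_eq_0_iff[OF assms] by (simp add: AE_count_space)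
  moreover have "(\<forall>\<alpha>\<in>I. enn2real (a \<alpha>) = 0) \<longleftrightarrow> (\<forall>\<alpha>\<in>I. a \<alpha> = 0)" if "\<forall>\<alpha>\<in>I. a \<alpha> < \<infinity>"
    using that by (metis enn2real_eq_0_iff infinity_ennreal_def less_irrefl)
  moreover have "\<exists>\<alpha>\<in>I. a \<alpha> \<noteq> 0" if "\<not> (\<forall>\<alpha>\<in>I. a \<alpha> < \<infinity>)"
    using that by force
  ultimately show ?thesis by (auto simp: family_norm_def)
qed

lemma family_norm_scale:
  assumes "banach_ideal_space (count_space I) E" "0 \<le> c"
  shows "family_norm I E (\<lambda>\<alpha>. ennreal c * a \<alpha>) = ennreal c * family_norm I E a"
proof (cases "c = 0")
  case True
  then show ?thesis using family_norm_eq_0_iff[OF assms(1)] by simp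
next
  case False
  have "E (\<lambda>\<alpha>. enn2real (ennreal c * a \<alpha>)) = ennreal c * E (\<lambda>\<alpha>. enn2real (a \<alpha>))"
    using ideal_norm_scale[OF assms(1), of "\<lambda>\<alpha>. enn2real (a \<alpha>)" c] assms(2)
    by (simp add: enn2real_mult)
  then show ?thesis
    using False assms(2) by (auto simp: family_norm_def ennreal_mult_less_top ennreal_mult_top)
qed

lemma family_norm_triangle:
  assumes "banach_ideal_space (count_space I) E"
  shows "family_norm I E (\<lambda>\<alpha>. a \<alpha> + b \<alpha>) \<le> family_norm I E a + family_norm I E b"
proof (cases "\<forall>\<alpha>\<in>I. a \<alpha> < \<infinity> \<and> b \<alpha> < \<infinity>")
  case True
  have "E (\<lambda>\<alpha>. enn2real (a \<alpha> + b \<alpha>)) = E (\<lambda>\<alpha>. enn2real (a \<alpha>) + enn2real (b \<alpha>))"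
    using True by (intro ideal_norm_cong[OF assms]) (auto simp: AE_count_space enn2real_plus)
  also have "\<dots> \<le> E (\<lambda>\<alpha>. enn2real (a \<alpha>)) + E (\<lambda>\<alpha>. enn2real (b \<alpha>))"
    by (rule ideal_norm_triangle[OF assms]) auto
  finally show ?thesis using True by (auto simp: family_norm_def)
qed (auto simp: family_norm_def)

text \<open>
  A unit vector is finite in norm because it lies below a multiple of the strictly positive element
  that every Banach ideal space contains.
\<close>

lemma unit_norm_pos_finite:
  assumes "banach_ideal_space (count_space I) E" "\<alpha> \<in> I"
  shows "0 < E (indicator {\<alpha>})" "E (indicator {\<alpha>}) < \<infinity>"
proof -
  have "E (indicator {\<alpha>}) \<noteq> 0"
    using ideal_norm_eq_0_iff[OF assms(1), of "indicator {\<alpha>}"] assms(2)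
    by (auto simp: AE_count_space)
  then show "0 < E (indicator {\<alpha>})" by (simp add: zero_less_iff_neq_zero)
  have "\<exists>f \<in> ideal_carrier (count_space I) E. \<forall>x \<in> space (count_space I). 0 < f x"
    using assms(1) unfolding banach_ideal_space_def by blast
  then obtain w where w: "w \<in> ideal_carrier (count_space I) E" "\<forall>\<beta>\<in>I. 0 < w \<beta>"
    by auto
  have "E (indicator {\<alpha>}) \<le> E (\<lambda>\<beta>. (1 / w \<alpha>) * w \<beta>)"
    using w(2) assms(2)
    by (intro ideal_norm_mono[OF assms(1)]) (auto simp: AE_count_space indicator_def)
  also have "\<dots> = ennreal \<bar>1 / w \<alpha>\<bar> * E w"
    by (rule ideal_norm_scale[OF assms(1)]) simp
  also have "\<dots> < \<infinity>"
    using w(1) by (simp add: ideal_carrier_iff ennreal_mult_less_top)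
  finally show "E (indicator {\<alpha>}) < \<infinity>" .
qed

lemma family_norm_coordinate:
  assumes "banach_ideal_space (count_space I) E" "\<alpha> \<in> I"
  shows "a \<alpha> * E (indicator {\<alpha>}) \<le> family_norm I E a"
proof (cases "\<forall>\<alpha>\<in>I. a \<alpha> < \<infinity>")
  case True
  have "a \<alpha> * E (indicator {\<alpha>}) = E (\<lambda>\<beta>. enn2real (a \<alpha>) * indicator {\<alpha>} \<beta>)"
    using ideal_norm_scale[OF assms(1), of "indicator {\<alpha>}" "enn2real (a \<alpha>)"] True assms(2) by simp
  also have "\<dots> \<le> E (\<lambda>\<alpha>. enn2real (a \<alpha>))"
    by (intro ideal_norm_mono[OF assms(1)]) (auto simp: AE_count_space indicator_def)
  finally show ?thesis using True by (simp add: family_norm_def)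
qed (auto simp: family_norm_def)

text \<open>
  The coordinatewise limit may a priori be infinite somewhere. If the norms are bounded, it is not:
  by \<open>family_norm_coordinate\<close> each coordinate is at most the bound divided by the positive norm of
  the unit vector. After that the Fatou property applies to the real families.
\<close>

lemma family_norm_SUP:
  fixes a :: "nat \<Rightarrow> 'i \<Rightarrow> ennreal"
  assumes E: "banach_ideal_space (count_space I) E" "fatou_property (count_space I) E"
    and inc: "\<And>\<alpha>. \<alpha> \<in> I \<Longrightarrow> incseq (\<lambda>n. a n \<alpha>)"
  shows "family_norm I E (\<lambda>\<alpha>. SUP n. a n \<alpha>) = (SUP n. family_norm I E (a n))"
proof (rule antisym)
  show "(SUP n. family_norm I E (a n)) \<le> family_norm I E (\<lambda>\<alpha>. SUP n. a n \<alpha>)"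
    by (intro SUP_least family_norm_mono[OF E(1)] SUP_upper) simp
  show "family_norm I E (\<lambda>\<alpha>. SUP n. a n \<alpha>) \<le> (SUP n. family_norm I E (a n))" (is "_ \<le> ?s")
  proof (cases "?s < \<infinity>")
    case False
    then have "?s = \<infinity>" by (simp only: infinity_ennreal_def less_top[symmetric] not_not)
    then show ?thesis by (simp only: infinity_ennreal_def top_greatest)
  next
    case True
    have sup_fin: "(SUP n. a n \<alpha>) < \<infinity>" if "\<alpha> \<in> I" for \<alpha>
    proof -
      have "(SUP n. a n \<alpha>) * E (indicator {\<alpha>}) = (SUP n. a n \<alpha> * E (indicator {\<alpha>}))"
        by (rule SUP_mult_right_ennreal)
      also have "\<dots> \<le> ?s"
        by (intro SUP_mono) (auto intro: family_norm_coordinate[OF E(1) that])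
      finally have "(SUP n. a n \<alpha>) * E (indicator {\<alpha>}) < \<infinity>"
        using True by (rule le_less_trans)
      then show ?thesis
        using unit_norm_pos_finite[OF E(1) that] by (auto simp: ennreal_mult_less_top)
    qed
    have fin: "a n \<alpha> < \<infinity>" if "\<alpha> \<in> I" for \<alpha> n
      using sup_fin[OF that] SUP_upper[of n UNIV "\<lambda>n. a n \<alpha>"] by (simp add: le_less_trans)
    have "E (\<lambda>\<alpha>. enn2real (SUP n. a n \<alpha>)) = (SUP n. E (\<lambda>\<alpha>. enn2real (a n \<alpha>)))"
    proof (rule ideal_norm_SUP(2)[OF E, symmetric], simp_all add: AE_count_space, intro ballI conjI)
      fix \<alpha> assume \<alpha>: "\<alpha> \<in> I"
      show "incseq (\<lambda>n. enn2real (a n \<alpha>))"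
        using inc[OF \<alpha>] fin[OF \<alpha>] by (auto simp: incseq_def intro!: enn2real_mono)
      have "(\<lambda>n. a n \<alpha>) \<longlonglongrightarrow> ennreal (enn2real (SUP n. a n \<alpha>))"
        using LIMSEQ_SUP[OF inc[OF \<alpha>]] sup_fin[OF \<alpha>] by simp
      then show "(\<lambda>n. enn2real (a n \<alpha>)) \<longlonglongrightarrow> enn2real (SUP n. a n \<alpha>)"
        by (rule tendsto_enn2real) simp
    qed
    then show ?thesis
      using sup_fin fin by (simp add: family_norm_def)
  qed
qed

lemma family_hoelder:
  assumes "banach_ideal_space (count_space I) E"
    and "family_norm I E a < \<infinity>" "family_norm I (koethe_dual_norm (count_space I) E) b < \<infinity>"
  shows "(\<integral>\<^sup>+ \<alpha>. a \<alpha> * b \<alpha> \<partial>count_space I)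
    \<le> family_norm I E a * family_norm I (koethe_dual_norm (count_space I) E) b"
proof -
  have fin: "a \<alpha> < \<infinity>" "b \<alpha> < \<infinity>" if "\<alpha> \<in> I" for \<alpha>
    using assms(2,3) that unfolding family_norm_less_top_iff by blast+
  have "(\<integral>\<^sup>+ \<alpha>. a \<alpha> * b \<alpha> \<partial>count_space I)
      = (\<integral>\<^sup>+ \<alpha>. ennreal \<bar>enn2real (a \<alpha>) * enn2real (b \<alpha>)\<bar> \<partial>count_space I)"
    using fin by (intro nn_integral_cong) (simp add: ennreal_mult)
  also have "\<dots> \<le> E (\<lambda>\<alpha>. enn2real (a \<alpha>)) * koethe_dual_norm (count_space I) E (\<lambda>\<alpha>. enn2real (b \<alpha>))"
    using assms(2) unfolding family_norm_less_top_iff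
    by (intro koethe_dual_hoelder[OF assms(1)]) simp_all
  finally show ?thesis using fin by (simp add: family_norm_def)
qed

lemma nn_integral_count_space_le_if_finite_sums_le:
  fixes h :: "'i \<Rightarrow> ennreal"
  assumes "countable I" and sums: "\<And>F. finite F \<Longrightarrow> F \<subseteq> I \<Longrightarrow> sum h F \<le> C"
  shows "(\<integral>\<^sup>+ \<alpha>. h \<alpha> \<partial>count_space I) \<le> C"
proof (cases "finite I")
  case True
  then show ?thesis using sums[of I] by (simp add: nn_integral_count_space_finite)
next
  case False
  have bij: "bij_betw (from_nat_into I) UNIV I"
    by (rule bij_betw_from_nat_into[OF assms(1) False])
  have "(\<integral>\<^sup>+ \<alpha>. h \<alpha> \<partial>count_space I) = (\<Sum>n. h (from_nat_into I n))"
    using nn_integral_bij_count_space[OF bij, of h] by (simp add: nn_integral_count_space_nat)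
  also have "\<dots> = (SUP n. \<Sum>k<n. h (from_nat_into I k))"
    by (rule suminf_eq_SUP)
  also have "\<dots> \<le> C"
  proof (rule SUP_least)
    fix n
    have "(\<Sum>k<n. h (from_nat_into I k)) = sum h (from_nat_into I ` {..<n})"
      using bij by (intro sum.reindex_cong[symmetric, where l = "from_nat_into I"])
        (auto simp: bij_betw_def intro: inj_on_subset)
    also have "\<dots> \<le> C"
      using bij by (intro sums) (auto simp: bij_betw_def)
    finally show "(\<Sum>k<n. h (from_nat_into I k)) \<le> C" .
  qed
  finally show ?thesis .
qed

section \<open>The Koethe-Herz norm\<close>

text \<open>
  Distinct blocks may overlap in a null set, so functions on different blocks are compared and
  glued only almost everywhere; this is always reduced to \<open>AE_disjoint\<close> and \<open>AE_covered\<close> below.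
\<close>

locale koethe_herz =
  fixes M :: "'a measure"
    and I :: "'i set"
    and \<Omega> :: "'i \<Rightarrow> 'a set"
    and X :: "'i \<Rightarrow> ('a \<Rightarrow> real) \<Rightarrow> ennreal"
    and E :: "('i \<Rightarrow> real) \<Rightarrow> ennreal"
  assumes countable_I: "countable I"
    and partition: "measurable_partition M I \<Omega>"
    and X_ideal: "\<And>\<alpha>. \<alpha> \<in> I \<Longrightarrow> banach_ideal_space (restrict_space M (\<Omega> \<alpha>)) (X \<alpha>)"
    and E_ideal: "banach_ideal_space (count_space I) E"
    and E_fatou: "fatou_property (count_space I) E"
    and X_fatou: "\<And>\<alpha>. \<alpha> \<in> I \<Longrightarrow> fatou_property (restrict_space M (\<Omega> \<alpha>)) (X \<alpha>)"
begin

definition block_norm :: "('a \<Rightarrow> real) \<Rightarrow> 'i \<Rightarrow> ennreal" where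
  "block_norm f \<alpha> = X \<alpha> (\<lambda>x. f x * indicator (\<Omega> \<alpha>) x)"

abbreviation herz_norm :: "('a \<Rightarrow> real) \<Rightarrow> ennreal" where
  "herz_norm \<equiv> koethe_herz_norm M I \<Omega> X E"

abbreviation dual_block_norm :: "'a set \<Rightarrow> 'i \<Rightarrow> ennreal" where
  "dual_block_norm B \<alpha> \<equiv> koethe_dual_norm (restrict_space M (\<Omega> \<alpha>)) (X \<alpha>) (indicator (\<Omega> \<alpha> \<inter> B))"

abbreviation dual_herz_norm :: "'a set \<Rightarrow> ennreal" where
  "dual_herz_norm B \<equiv> family_norm I (koethe_dual_norm (count_space I) E) (dual_block_norm B)"

lemma block_sets: "\<alpha> \<in> I \<Longrightarrow> \<Omega> \<alpha> \<in> sets M"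
  using partition by (simp add: measurable_partition_def)

lemma block_sets_space: "\<alpha> \<in> I \<Longrightarrow> \<Omega> \<alpha> \<inter> space M \<in> sets M"
  by (simp add: block_sets)

lemma AE_block_iff:
  "\<alpha> \<in> I \<Longrightarrow> (AE x in restrict_space M (\<Omega> \<alpha>). P x) \<longleftrightarrow> (AE x in M. x \<in> \<Omega> \<alpha> \<longrightarrow> P x)"
  by (rule AE_restrict_space_iff[OF block_sets_space])

lemma AE_covered: "AE x in M. \<exists>\<alpha>\<in>I. x \<in> \<Omega> \<alpha>"
  using partition by (auto simp: measurable_partition_def)

lemma AE_disjoint:
  assumes "\<alpha> \<in> I"
  shows "AE x in M. \<forall>\<beta>\<in>I. x \<in> \<Omega> \<alpha> \<longrightarrow> x \<in> \<Omega> \<beta> \<longrightarrow> \<beta> = \<alpha>"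
proof (rule AE_ball_countable'[OF _ countable_I])
  fix \<beta> assume \<beta>: "\<beta> \<in> I"
  show "AE x in M. x \<in> \<Omega> \<alpha> \<longrightarrow> x \<in> \<Omega> \<beta> \<longrightarrow> \<beta> = \<alpha>"
  proof (cases "\<beta> = \<alpha>")
    case False
    then have "\<Omega> \<alpha> \<inter> \<Omega> \<beta> \<in> null_sets M"
      using partition assms \<beta> block_sets by (auto simp: measurable_partition_def intro!: null_setsI)
    from AE_not_in[OF this] show ?thesis by eventually_elim auto
  qed simp
qed

lemma cutoff_measurable:
  fixes f :: "'a \<Rightarrow> real"
  assumes "f \<in> borel_measurable M" "\<alpha> \<in> I"
  shows "(\<lambda>x. f x * indicator (\<Omega> \<alpha>) x) \<in> borel_measurable (restrict_space M (\<Omega> \<alpha>))"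
  using assms(1) block_sets[OF assms(2)]
  by (intro measurable_restrict_space1 borel_measurable_times borel_measurable_indicator)

lemma indicator_block_measurable:
  assumes "\<alpha> \<in> I" "B \<in> sets M"
  shows "(indicator (\<Omega> \<alpha> \<inter> B) :: 'a \<Rightarrow> real) \<in> borel_measurable (restrict_space M (\<Omega> \<alpha>))"
  using block_sets[OF assms(1)] assms(2)
  by (intro measurable_restrict_space1 borel_measurable_indicator) simp

lemma extension_by_zero_measurable:
  fixes g :: "'a \<Rightarrow> real"
  assumes "g \<in> borel_measurable (restrict_space M (\<Omega> \<alpha>))" "\<alpha> \<in> I"
  shows "(\<lambda>x. \<bar>g x\<bar> * indicator (\<Omega> \<alpha>) x) \<in> borel_measurable M"
proof -
  have "(\<lambda>x. \<bar>g x\<bar>) \<in> borel_measurable (restrict_space M (\<Omega> \<alpha>))"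
    using assms(1) by simp
  then show ?thesis
    unfolding borel_measurable_restrict_space_iff[OF block_sets_space[OF assms(2)]]
    by (simp add: mult.commute)
qed

lemma herz_space_iff:
  assumes "f \<in> borel_measurable M"
  shows "f \<in> koethe_herz_space M I \<Omega> X E \<longleftrightarrow> family_norm I E (block_norm f) < \<infinity>"
  unfolding family_norm_less_top_iff koethe_herz_space_def
  using assms cutoff_measurable[OF assms] by (auto simp: ideal_carrier_iff block_norm_def)

text \<open>
  Membership in the space is the same as finiteness of the norm, so the case distinction in the
  definition of the norm disappears for measurable functions.
\<close>

lemma herz_norm_eq:
  assumes "f \<in> borel_measurable M"
  shows "herz_norm f = family_norm I E (block_norm f)"
proof (cases "f \<in> koethe_herz_space M I \<Omega> X E")
  case True
  then show ?thesis by (simp add: koethe_herz_norm_def block_norm_def[abs_def])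
next
  case False
  then have "family_norm I E (block_norm f) = \<infinity>"
    using herz_space_iff[OF assms] by (simp only: infinity_ennreal_def less_top[symmetric] not_not)
  with False show ?thesis by (simp add: koethe_herz_norm_def)
qed

lemma block_norm_mono:
  assumes "f \<in> borel_measurable M" "g \<in> borel_measurable M" "\<alpha> \<in> I"
    and "AE x in M. x \<in> \<Omega> \<alpha> \<longrightarrow> \<bar>f x\<bar> \<le> \<bar>g x\<bar>"
  shows "block_norm f \<alpha> \<le> block_norm g \<alpha>"
  unfolding block_norm_def
proof (rule ideal_norm_mono[OF X_ideal[OF assms(3)]])
  show "AE x in restrict_space M (\<Omega> \<alpha>). \<bar>f x * indicator (\<Omega> \<alpha>) x\<bar> \<le> \<bar>g x * indicator (\<Omega> \<alpha>) x\<bar>"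
    using assms(4) unfolding AE_block_iff[OF assms(3)] by eventually_elim auto
qed (auto intro: cutoff_measurable assms)

lemma block_norm_eq_0_iff:
  assumes "f \<in> borel_measurable M" "\<alpha> \<in> I"
  shows "block_norm f \<alpha> = 0 \<longleftrightarrow> (AE x in M. x \<in> \<Omega> \<alpha> \<longrightarrow> f x = 0)"
proof -
  have "block_norm f \<alpha> = 0 \<longleftrightarrow> (AE x in M. x \<in> \<Omega> \<alpha> \<longrightarrow> f x * indicator (\<Omega> \<alpha>) x = 0)"
    unfolding block_norm_def
    by (simp only: ideal_norm_eq_0_iff[OF X_ideal[OF assms(2)] cutoff_measurable[OF assms]]
      AE_block_iff[OF assms(2)])
  also have "\<dots> \<longleftrightarrow> (AE x in M. x \<in> \<Omega> \<alpha> \<longrightarrow> f x = 0)"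
    by (intro AE_cong) auto
  finally show ?thesis .
qed

lemma herz_norm_mono:
  assumes "f \<in> borel_measurable M" "g \<in> borel_measurable M" "AE x in M. \<bar>f x\<bar> \<le> \<bar>g x\<bar>"
  shows "herz_norm f \<le> herz_norm g"
  unfolding herz_norm_eq[OF assms(1)] herz_norm_eq[OF assms(2)]
  using assms by (intro family_norm_mono[OF E_ideal] block_norm_mono) auto

lemma herz_norm_abs:
  assumes "f \<in> borel_measurable M"
  shows "herz_norm (\<lambda>x. \<bar>f x\<bar>) = herz_norm f"
  using assms by (intro antisym herz_norm_mono) auto

lemma herz_norm_eq_0_iff:
  assumes "f \<in> borel_measurable M"
  shows "herz_norm f = 0 \<longleftrightarrow> (AE x in M. f x = 0)"
proof -
  have "herz_norm f = 0 \<longleftrightarrow> (\<forall>\<alpha>\<in>I. AE x in M. x \<in> \<Omega> \<alpha> \<longrightarrow> f x = 0)"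
    unfolding herz_norm_eq[OF assms] family_norm_eq_0_iff[OF E_ideal]
    using block_norm_eq_0_iff[OF assms] by blast
  also have "\<dots> \<longleftrightarrow> (AE x in M. \<forall>\<alpha>\<in>I. x \<in> \<Omega> \<alpha> \<longrightarrow> f x = 0)"
    by (rule AE_ball_countable[OF countable_I, symmetric])
  also have "\<dots> \<longleftrightarrow> (AE x in M. f x = 0)"
  proof
    assume "AE x in M. \<forall>\<alpha>\<in>I. x \<in> \<Omega> \<alpha> \<longrightarrow> f x = 0"
    with AE_covered show "AE x in M. f x = 0" by eventually_elim auto
  qed (auto elim: eventually_mono)
  finally show ?thesis .
qed

lemma herz_norm_scale:
  assumes "f \<in> borel_measurable M" "0 \<le> c"
  shows "herz_norm (\<lambda>x. c * f x) = ennreal c * herz_norm f"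
proof -
  have "herz_norm (\<lambda>x. c * f x) = family_norm I E (block_norm (\<lambda>x. c * f x))"
    using assms(1) by (intro herz_norm_eq) simp
  also have "\<dots> = family_norm I E (\<lambda>\<alpha>. ennreal c * block_norm f \<alpha>)"
  proof (rule family_norm_cong[OF E_ideal])
    fix \<alpha> assume "\<alpha> \<in> I"
    then show "block_norm (\<lambda>x. c * f x) \<alpha> = ennreal c * block_norm f \<alpha>"
      using ideal_norm_scale[OF X_ideal cutoff_measurable[OF assms(1)], of \<alpha> c] assms(2)
      by (simp add: block_norm_def mult.assoc)
  qed
  also have "\<dots> = ennreal c * herz_norm f"
    by (simp add: family_norm_scale[OF E_ideal assms(2)] herz_norm_eq[OF assms(1)])
  finally show ?thesis .
qed

lemma herz_norm_triangle:
  assumes "f \<in> borel_measurable M" "g \<in> borel_measurable M"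
  shows "herz_norm (\<lambda>x. f x + g x) \<le> herz_norm f + herz_norm g"
proof -
  have "herz_norm (\<lambda>x. f x + g x) = family_norm I E (block_norm (\<lambda>x. f x + g x))"
    using assms by (intro herz_norm_eq) simp
  also have "\<dots> \<le> family_norm I E (\<lambda>\<alpha>. block_norm f \<alpha> + block_norm g \<alpha>)"
  proof (rule family_norm_mono[OF E_ideal])
    fix \<alpha> assume "\<alpha> \<in> I"
    then show "block_norm (\<lambda>x. f x + g x) \<alpha> \<le> block_norm f \<alpha> + block_norm g \<alpha>"
      using ideal_norm_triangle[OF X_ideal cutoff_measurable[OF assms(1)] cutoff_measurable[OF assms(2)]]
      by (simp add: block_norm_def distrib_right)
  qed
  also have "\<dots> \<le> herz_norm f + herz_norm g"
    by (simp add: family_norm_triangle[OF E_ideal] herz_norm_eq assms)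
  finally show ?thesis .
qed

text \<open>
  Apply \<open>ideal_norm_SUP\<close> on each block and then \<open>family_norm_SUP\<close> to the increasing families of
  block norms.
\<close>

lemma herz_norm_SUP:
  fixes u :: "nat \<Rightarrow> 'a \<Rightarrow> real"
  assumes f: "f \<in> borel_measurable M" and u: "\<And>n. u n \<in> borel_measurable M"
    and pos: "\<And>n. AE x in M. 0 \<le> u n x"
    and lim: "AE x in M. incseq (\<lambda>n. u n x) \<and> (\<lambda>n. u n x) \<longlonglongrightarrow> f x"
  shows "incseq (\<lambda>n. herz_norm (u n))" "(SUP n. herz_norm (u n)) = herz_norm f"
proof -
  have block: "incseq (\<lambda>n. block_norm (u n) \<alpha>)" "(SUP n. block_norm (u n) \<alpha>) = block_norm f \<alpha>"
    if "\<alpha> \<in> I" for \<alpha>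
  proof -
    note fatou = ideal_norm_SUP[OF X_ideal[OF that] X_fatou[OF that] cutoff_measurable[OF f that]
        cutoff_measurable[OF u that]]
    have pos': "AE x in restrict_space M (\<Omega> \<alpha>). 0 \<le> u n x * indicator (\<Omega> \<alpha>) x" for n
      using pos[of n] unfolding AE_block_iff[OF that] by eventually_elim auto
    have lim': "AE x in restrict_space M (\<Omega> \<alpha>). incseq (\<lambda>n. u n x * indicator (\<Omega> \<alpha>) x) \<and>
        (\<lambda>n. u n x * indicator (\<Omega> \<alpha>) x) \<longlonglongrightarrow> f x * indicator (\<Omega> \<alpha>) x"
      using lim unfolding AE_block_iff[OF that] by eventually_elim auto
    show "incseq (\<lambda>n. block_norm (u n) \<alpha>)" "(SUP n. block_norm (u n) \<alpha>) = block_norm f \<alpha>"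
      unfolding block_norm_def using fatou[OF pos' lim'] by blast+
  qed
  have eq: "herz_norm (u n) = family_norm I E (block_norm (u n))" for n
    by (rule herz_norm_eq[OF u])
  show "incseq (\<lambda>n. herz_norm (u n))"
    unfolding eq using block(1)
    by (intro incseq_SucI family_norm_mono[OF E_ideal]) (auto dest: incseq_SucD)
  have "(SUP n. herz_norm (u n)) = family_norm I E (\<lambda>\<alpha>. SUP n. block_norm (u n) \<alpha>)"
    unfolding eq using block(1) by (intro family_norm_SUP[OF E_ideal E_fatou, symmetric])
  also have "\<dots> = family_norm I E (block_norm f)"
    by (rule family_norm_cong[OF E_ideal block(2)])
  finally show "(SUP n. herz_norm (u n)) = herz_norm f"
    by (simp add: herz_norm_eq[OF f])
qed

lemma herz_norm_indicator:
  assumes "B \<in> sets M"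
  shows "herz_norm (indicator B) = family_norm I E (\<lambda>\<alpha>. X \<alpha> (indicator (\<Omega> \<alpha> \<inter> B)))"
proof -
  have "(\<lambda>x. indicator B x * indicator (\<Omega> \<alpha>) x) = (indicator (\<Omega> \<alpha> \<inter> B) :: 'a \<Rightarrow> real)" for \<alpha>
    by (auto simp: indicator_def)
  then show ?thesis
    using assms by (simp add: herz_norm_eq block_norm_def[abs_def])
qed

text \<open>
  All the axioms that do not mention sets of finite measure hold automatically, so only the two
  local ones survive.
\<close>

lemma banach_function_space_iff:
  "banach_function_space M (koethe_herz_space M I \<Omega> X E) herz_norm \<longleftrightarrow>
    (\<forall>B\<in>sets M. emeasure M B < \<infinity> \<longrightarrow>
      family_norm I E (\<lambda>\<alpha>. X \<alpha> (indicator (\<Omega> \<alpha> \<inter> B))) < \<infinity> \<and>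
      (\<exists>C::real. 0 < C \<and> (\<forall>f\<in>L0_nonneg M. (\<integral>\<^sup>+ x\<in>B. ennreal (f x) \<partial>M) \<le> ennreal C * herz_norm f)))"
proof -
  have meas: "f \<in> borel_measurable M" if "f \<in> L0_nonneg M" for f
    using that by (simp add: L0_nonneg_def)
  have P3: "incseq (\<lambda>n. herz_norm (u n)) \<and> (\<lambda>n. herz_norm (u n)) \<longlonglongrightarrow> herz_norm f"
    if "f \<in> L0_nonneg M" "\<forall>n. u n \<in> L0_nonneg M"
      "AE x in M. incseq (\<lambda>n. u n x) \<and> (\<lambda>n. u n x) \<longlonglongrightarrow> f x" for f u
  proof -
    have "incseq (\<lambda>n. herz_norm (u n))" "(SUP n. herz_norm (u n)) = herz_norm f"
      using that by (auto simp: L0_nonneg_def intro!: herz_norm_SUP)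
    then show ?thesis using LIMSEQ_SUP[of "\<lambda>n. herz_norm (u n)"] by simp
  qed
  have P2: "herz_norm f \<le> herz_norm g"
    if "f \<in> L0_nonneg M" "g \<in> L0_nonneg M" "AE x in M. f x \<le> g x" for f g
  proof (rule herz_norm_mono)
    have "AE x in M. 0 \<le> f x" using that(1) by (simp add: L0_nonneg_def)
    then show "AE x in M. \<bar>f x\<bar> \<le> \<bar>g x\<bar>" using that(3) by eventually_elim auto
  qed (use that meas in auto)
  have "koethe_herz_space M I \<Omega> X E = {f \<in> borel_measurable M. herz_norm (\<lambda>x. \<bar>f x\<bar>) < \<infinity>}"
  proof (rule set_eqI)
    fix f
    show "f \<in> koethe_herz_space M I \<Omega> X E \<longleftrightarrow> f \<in> {f \<in> borel_measurable M. herz_norm (\<lambda>x. \<bar>f x\<bar>) < \<infinity>}"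
    proof (cases "f \<in> borel_measurable M")
      case True
      then show ?thesis by (simp add: herz_space_iff herz_norm_abs herz_norm_eq)
    qed (simp add: koethe_herz_space_def)
  qed
  moreover have "\<forall>f\<in>koethe_herz_space M I \<Omega> X E. herz_norm f = herz_norm (\<lambda>x. \<bar>f x\<bar>)"
    by (auto simp: koethe_herz_space_def herz_norm_abs)
  moreover have "\<forall>B\<in>sets M. herz_norm (indicator B) = family_norm I E (\<lambda>\<alpha>. X \<alpha> (indicator (\<Omega> \<alpha> \<inter> B)))"
    by (simp add: herz_norm_indicator)
  moreover have "function_norm M herz_norm \<longleftrightarrow>
      (\<forall>B\<in>sets M. emeasure M B < \<infinity> \<longrightarrow> herz_norm (indicator B) < \<infinity>) \<and>
      (\<forall>B\<in>sets M. emeasure M B < \<infinity> \<longrightarrow> (\<exists>C::real. 0 < C \<and>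
        (\<forall>f\<in>L0_nonneg M. (\<integral>\<^sup>+ x\<in>B. ennreal (f x) \<partial>M) \<le> ennreal C * herz_norm f)))"
    (is "_ \<longleftrightarrow> ?finite_on_sets \<and> ?local_bound")
  proof
    assume "function_norm M herz_norm"
    then show "?finite_on_sets \<and> ?local_bound"
      unfolding function_norm_def by (elim conjE) (intro conjI; assumption)
  next
    assume "?finite_on_sets \<and> ?local_bound"
    then show "function_norm M herz_norm"
      unfolding function_norm_def
      by (elim conjE, intro conjI)
        (use P2 P3 herz_norm_eq_0_iff[OF meas] herz_norm_scale[OF meas]
          herz_norm_triangle[OF meas meas] in \<open>assumption | blast\<close>)+
  qed
  ultimately show ?thesis
    unfolding banach_function_space_def by auto
qed

section \<open>Duality with the local integrals\<close>

lemma nn_integral_block: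
  fixes g :: "'a \<Rightarrow> real"
  assumes "\<alpha> \<in> I"
  shows "(\<integral>\<^sup>+ x. ennreal \<bar>g x * indicator (\<Omega> \<alpha> \<inter> B) x\<bar> \<partial>restrict_space M (\<Omega> \<alpha>))
    = (\<integral>\<^sup>+ x\<in>B. ennreal (\<bar>g x\<bar> * indicator (\<Omega> \<alpha>) x) \<partial>M)"
  unfolding nn_integral_restrict_space[OF block_sets_space[OF assms]]
  by (intro nn_integral_cong) (simp add: indicator_def)

text \<open>
  Hoelder inequality twice: on each block for the pairing of \<open>X\<^sub>\<alpha>\<close> with \<open>X\<^sub>\<alpha>'\<close>, then for the pairing
  of \<open>E\<close> with \<open>E'\<close>. Since the blocks cover the space, the integral over \<open>B\<close> is at most the
  sum of the integrals over the blocks.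
\<close>

lemma integral_le_dual_norm:
  assumes f: "f \<in> L0_nonneg M" and B: "B \<in> sets M"
    and fin: "herz_norm f < \<infinity>" "dual_herz_norm B < \<infinity>"
  shows "(\<integral>\<^sup>+ x\<in>B. ennreal (f x) \<partial>M) \<le> herz_norm f * dual_herz_norm B"
proof -
  have f_meas: "f \<in> borel_measurable M" using f by (simp add: L0_nonneg_def)
  note [measurable] = f_meas B
  define F where "F \<alpha> x = ennreal (\<bar>f x\<bar> * indicator (\<Omega> \<alpha>) x) * indicator B x" for \<alpha> x
  have F_meas: "F \<alpha> \<in> borel_measurable M" if "\<alpha> \<in> I" for \<alpha>
    using block_sets[OF that] unfolding F_def by measurable
  have fin': "family_norm I E (block_norm f) < \<infinity>"
    using fin(1) by (simp add: herz_norm_eq[OF f_meas])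
  have "(\<integral>\<^sup>+ x\<in>B. ennreal (f x) \<partial>M) \<le> (\<integral>\<^sup>+ x. \<integral>\<^sup>+ \<alpha>. F \<alpha> x \<partial>count_space I \<partial>M)"
  proof (rule nn_integral_mono_AE)
    show "AE x in M. ennreal (f x) * indicator B x \<le> (\<integral>\<^sup>+ \<alpha>. F \<alpha> x \<partial>count_space I)"
      using AE_covered
    proof eventually_elim
      case (elim x)
      then obtain \<alpha> where \<alpha>: "\<alpha> \<in> I" "x \<in> \<Omega> \<alpha>" by blast
      then have "ennreal (f x) * indicator B x \<le> F \<alpha> x"
        by (auto simp: F_def indicator_def intro: ennreal_leI)
      also have "\<dots> \<le> (\<integral>\<^sup>+ \<alpha>. F \<alpha> x \<partial>count_space I)"
        by (rule nn_integral_ge_point[OF \<alpha>(1)])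
      finally show ?case .
    qed
  qed
  also have "\<dots> = (\<integral>\<^sup>+ \<alpha>. \<integral>\<^sup>+ x. F \<alpha> x \<partial>M \<partial>count_space I)"
    by (rule nn_integral_count_space_nn_integral[OF countable_I F_meas])
  also have "\<dots> \<le> (\<integral>\<^sup>+ \<alpha>. block_norm f \<alpha> * dual_block_norm B \<alpha> \<partial>count_space I)"
  proof (rule nn_integral_mono)
    fix \<alpha> assume "\<alpha> \<in> space (count_space I)"
    then have \<alpha>: "\<alpha> \<in> I" by simp
    have "(\<integral>\<^sup>+ x. F \<alpha> x \<partial>M)
        = (\<integral>\<^sup>+ x. ennreal \<bar>(f x * indicator (\<Omega> \<alpha>) x) * indicator (\<Omega> \<alpha> \<inter> B) x\<bar> \<partial>restrict_space M (\<Omega> \<alpha>))"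
      unfolding nn_integral_block[OF \<alpha>] F_def
      by (intro nn_integral_cong) (simp add: indicator_def)
    also have "\<dots> \<le> block_norm f \<alpha> * dual_block_norm B \<alpha>"
      unfolding block_norm_def
    proof (rule koethe_dual_hoelder[OF X_ideal[OF \<alpha>] cutoff_measurable[OF f_meas \<alpha>]])
      show "indicat_real (\<Omega> \<alpha> \<inter> B) \<in> borel_measurable (restrict_space M (\<Omega> \<alpha>))"
        by (rule indicator_block_measurable[OF \<alpha> B])
      show "X \<alpha> (\<lambda>x. f x * indicator (\<Omega> \<alpha>) x) < \<infinity>"
        using fin' \<alpha> unfolding family_norm_less_top_iff block_norm_def by blast
    qed
    finally show "(\<integral>\<^sup>+ x. F \<alpha> x \<partial>M) \<le> block_norm f \<alpha> * dual_block_norm B \<alpha>" .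
  qed
  also have "\<dots> \<le> family_norm I E (block_norm f) * dual_herz_norm B"
    by (rule family_hoelder[OF E_ideal fin' fin(2)])
  finally show ?thesis by (simp add: herz_norm_eq[OF f_meas])
qed

text \<open>
  On the block \<open>\<Omega>\<^sub>\<beta>\<close> only the summand with index \<open>\<beta>\<close> survives almost everywhere, so the family of block
  norms of the glued function is dominated by \<open>\<bar>a\<bar>\<close>. Gluing finitely many pieces suffices,
  because sums over \<open>I\<close> are suprema of finite sums.
\<close>

lemma herz_norm_glue_le:
  fixes a :: "'i \<Rightarrow> real" and g :: "'i \<Rightarrow> 'a \<Rightarrow> real"
  assumes F: "finite F" "F \<subseteq> I"
    and g: "\<And>\<alpha>. \<alpha> \<in> F \<Longrightarrow> g \<alpha> \<in> borel_measurable (restrict_space M (\<Omega> \<alpha>))"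
      "\<And>\<alpha>. \<alpha> \<in> F \<Longrightarrow> X \<alpha> (g \<alpha>) \<le> 1"
  defines "f \<equiv> \<lambda>x. \<Sum>\<alpha>\<in>F. \<bar>a \<alpha>\<bar> * (\<bar>g \<alpha> x\<bar> * indicator (\<Omega> \<alpha>) x)"
  shows "f \<in> L0_nonneg M" "herz_norm f \<le> E a"
proof -
  have g_meas: "(\<lambda>x. \<bar>g \<alpha> x\<bar> * indicator (\<Omega> \<alpha>) x) \<in> borel_measurable M" if "\<alpha> \<in> F" for \<alpha>
    using extension_by_zero_measurable g(1)[OF that] that F(2) by blast
  have f_meas: "f \<in> borel_measurable M"
    unfolding f_def by (intro borel_measurable_sum borel_measurable_times borel_measurable_const g_meas)
  have "0 \<le> f x" for x by (simp add: f_def sum_nonneg)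
  then show "f \<in> L0_nonneg M" using f_meas by (simp add: L0_nonneg_def)
  have block: "block_norm f \<beta> \<le> ennreal \<bar>a \<beta>\<bar>" if \<beta>: "\<beta> \<in> I" for \<beta>
  proof -
    have f_on_block: "AE x in M. x \<in> \<Omega> \<beta> \<longrightarrow> f x = (if \<beta> \<in> F then \<bar>a \<beta>\<bar> * \<bar>g \<beta> x\<bar> else 0)"
      using AE_disjoint[OF \<beta>]
    proof eventually_elim
      case (elim x)
      show ?case
      proof
        assume x: "x \<in> \<Omega> \<beta>"
        have "f x = (\<Sum>\<alpha>\<in>F. if \<alpha> = \<beta> then \<bar>a \<beta>\<bar> * \<bar>g \<beta> x\<bar> else 0)"
          unfolding f_def using elim x F(2) by (intro sum.cong) (auto simp: indicator_def)
        then show "f x = (if \<beta> \<in> F then \<bar>a \<beta>\<bar> * \<bar>g \<beta> x\<bar> else 0)"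
          using F(1) by (simp add: sum.delta)
      qed
    qed
    show ?thesis
    proof (cases "\<beta> \<in> F")
      case True
      have "block_norm f \<beta> = X \<beta> (\<lambda>x. a \<beta> * g \<beta> x)"
        unfolding block_norm_def
      proof (rule ideal_norm_cong[OF X_ideal[OF \<beta>] cutoff_measurable[OF f_meas \<beta>]])
        show "(\<lambda>x. a \<beta> * g \<beta> x) \<in> borel_measurable (restrict_space M (\<Omega> \<beta>))"
          using g(1)[OF True] by simp
        show "AE x in restrict_space M (\<Omega> \<beta>). \<bar>f x * indicator (\<Omega> \<beta>) x\<bar> = \<bar>a \<beta> * g \<beta> x\<bar>"
          unfolding AE_block_iff[OF \<beta>] using f_on_block
          by eventually_elim (use True in \<open>auto simp: abs_mult\<close>)
      qed
      also have "\<dots> = ennreal \<bar>a \<beta>\<bar> * X \<beta> (g \<beta>)"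
        by (rule ideal_norm_scale[OF X_ideal[OF \<beta>] g(1)[OF True]])
      also have "\<dots> \<le> ennreal \<bar>a \<beta>\<bar> * 1"
        by (intro mult_left_mono g(2)[OF True]) simp
      finally show ?thesis by simp
    next
      case False
      then have "block_norm f \<beta> = 0"
        using f_on_block by (simp add: block_norm_eq_0_iff[OF f_meas \<beta>])
      then show ?thesis by simp
    qed
  qed
  have "herz_norm f \<le> family_norm I E (\<lambda>\<alpha>. ennreal \<bar>a \<alpha>\<bar>)"
    unfolding herz_norm_eq[OF f_meas] by (intro family_norm_mono[OF E_ideal] block)
  then show "herz_norm f \<le> E a" by (simp add: family_norm_ennreal[OF E_ideal])
qed

text \<open>
  The assumed bound is tested on the glued function of \<open>herz_norm_glue_le\<close>.
\<close>

lemma finite_sum_le_integral_bound: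
  fixes a :: "'i \<Rightarrow> real" and g :: "'i \<Rightarrow> 'a \<Rightarrow> real"
  assumes B: "B \<in> sets M"
    and bound: "\<And>f. f \<in> L0_nonneg M \<Longrightarrow> (\<integral>\<^sup>+ x\<in>B. ennreal (f x) \<partial>M) \<le> ennreal C * herz_norm f"
    and F: "finite F" "F \<subseteq> I"
    and g: "\<And>\<alpha>. \<alpha> \<in> F \<Longrightarrow> g \<alpha> \<in> borel_measurable (restrict_space M (\<Omega> \<alpha>))"
      "\<And>\<alpha>. \<alpha> \<in> F \<Longrightarrow> X \<alpha> (g \<alpha>) \<le> 1"
  shows "(\<Sum>\<alpha>\<in>F. ennreal \<bar>a \<alpha>\<bar> *
      (\<integral>\<^sup>+ x. ennreal \<bar>g \<alpha> x * indicator (\<Omega> \<alpha> \<inter> B) x\<bar> \<partial>restrict_space M (\<Omega> \<alpha>))) \<le> ennreal C * E a"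
proof -
  let ?f = "\<lambda>x. \<Sum>\<alpha>\<in>F. \<bar>a \<alpha>\<bar> * (\<bar>g \<alpha> x\<bar> * indicator (\<Omega> \<alpha>) x)"
  have g_meas: "(\<lambda>x. ennreal (\<bar>g \<alpha> x\<bar> * indicator (\<Omega> \<alpha>) x) * indicator B x) \<in> borel_measurable M"
    if "\<alpha> \<in> F" for \<alpha>
  proof -
    have "(\<lambda>x. \<bar>g \<alpha> x\<bar> * indicator (\<Omega> \<alpha>) x) \<in> borel_measurable M"
      using extension_by_zero_measurable g(1)[OF that] that F(2) by blast
    then show ?thesis using B by measurable
  qed
  have "(\<Sum>\<alpha>\<in>F. ennreal \<bar>a \<alpha>\<bar> *
      (\<integral>\<^sup>+ x. ennreal \<bar>g \<alpha> x * indicator (\<Omega> \<alpha> \<inter> B) x\<bar> \<partial>restrict_space M (\<Omega> \<alpha>)))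
    = (\<Sum>\<alpha>\<in>F. ennreal \<bar>a \<alpha>\<bar> * (\<integral>\<^sup>+ x\<in>B. ennreal (\<bar>g \<alpha> x\<bar> * indicator (\<Omega> \<alpha>) x) \<partial>M))"
    using F(2) by (intro sum.cong) (auto simp: nn_integral_block)
  also have "\<dots> = (\<integral>\<^sup>+ x. (\<Sum>\<alpha>\<in>F. ennreal \<bar>a \<alpha>\<bar> *
      (ennreal (\<bar>g \<alpha> x\<bar> * indicator (\<Omega> \<alpha>) x) * indicator B x)) \<partial>M)"
    using g_meas by (subst nn_integral_sum) (auto simp: nn_integral_cmult intro!: sum.cong)
  also have "\<dots> = (\<integral>\<^sup>+ x\<in>B. ennreal (?f x) \<partial>M)"
    by (intro nn_integral_cong)
      (simp add: sum_ennreal[symmetric] ennreal_mult sum_distrib_right mult.assoc)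
  also have "\<dots> \<le> ennreal C * herz_norm ?f"
    by (rule bound[OF herz_norm_glue_le(1)[OF F g]])
  also have "\<dots> \<le> ennreal C * E a"
    by (intro mult_left_mono herz_norm_glue_le(2)[OF F g]) simp_all
  finally show ?thesis .
qed

text \<open>
  Test functions supported on a single block: those from the unit ball of \<open>X\<^sub>\<alpha>\<close> have Koethe-Herz norm
  at most that of the unit vector at \<open>\<alpha>\<close>.
\<close>

lemma dual_block_norm_finite:
  assumes B: "B \<in> sets M"
    and bound: "\<And>f. f \<in> L0_nonneg M \<Longrightarrow> (\<integral>\<^sup>+ x\<in>B. ennreal (f x) \<partial>M) \<le> ennreal C * herz_norm f"
    and \<alpha>: "\<alpha> \<in> I"
  shows "dual_block_norm B \<alpha> < \<infinity>"
proof -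
  have "dual_block_norm B \<alpha> \<le> ennreal C * E (indicator {\<alpha>})"
  proof (rule koethe_dual_norm_leI[OF indicator_block_measurable[OF \<alpha> B]])
    fix g assume "g \<in> borel_measurable (restrict_space M (\<Omega> \<alpha>))" "X \<alpha> g \<le> 1"
    then show "(\<integral>\<^sup>+ x. ennreal \<bar>g x * indicator (\<Omega> \<alpha> \<inter> B) x\<bar> \<partial>restrict_space M (\<Omega> \<alpha>))
        \<le> ennreal C * E (indicator {\<alpha>})"
      using finite_sum_le_integral_bound[OF B bound, of "{\<alpha>}" "\<lambda>_. g" "indicator {\<alpha>}"] \<alpha> by simp
  qed
  also have "\<dots> < \<infinity>"
    using unit_norm_pos_finite(2)[OF E_ideal \<alpha>] by (simp add: ennreal_mult_less_top)
  finally show ?thesis .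
qed

text \<open>
  The supremum defining a block norm of the dual need not be attained; a function reaching half of
  it is enough and costs only a factor \<open>2\<close>. Such a function exists because the block norms are
  already known to be finite.
\<close>

lemma dual_herz_norm_finite:
  assumes B: "B \<in> sets M"
    and bound: "\<And>f. f \<in> L0_nonneg M \<Longrightarrow> (\<integral>\<^sup>+ x\<in>B. ennreal (f x) \<partial>M) \<le> ennreal C * herz_norm f"
  shows "dual_herz_norm B < \<infinity>"
proof -
  have fin: "dual_block_norm B \<alpha> < \<infinity>" if "\<alpha> \<in> I" for \<alpha>
    by (rule dual_block_norm_finite[OF B _ that]) (rule bound)
  define pairing where "pairing \<alpha> g =
    (\<integral>\<^sup>+ x. ennreal \<bar>g x * indicator (\<Omega> \<alpha> \<inter> B) x\<bar> \<partial>restrict_space M (\<Omega> \<alpha>))" for \<alpha> g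
  have "\<exists>g. g \<in> borel_measurable (restrict_space M (\<Omega> \<alpha>)) \<and> X \<alpha> g \<le> 1 \<and>
      dual_block_norm B \<alpha> \<le> 2 * pairing \<alpha> g" if \<alpha>: "\<alpha> \<in> I" for \<alpha>
  proof (cases "dual_block_norm B \<alpha> = 0")
    case True
    then show ?thesis
      using ideal_norm_zero[OF X_ideal[OF \<alpha>]] by (intro exI[of _ "\<lambda>x. 0"]) simp
  next
    case False
    define d where "d = enn2real (dual_block_norm B \<alpha>)"
    have d: "0 < d" "dual_block_norm B \<alpha> = ennreal d"
      using False fin[OF \<alpha>] by (auto simp: d_def enn2real_positive_iff zero_less_iff_neq_zero)
    then have "ennreal (d / 2) < dual_block_norm B \<alpha>"
      by (simp add: ennreal_less_iff)
    then have "\<exists>g \<in> {f \<in> ideal_carrier (restrict_space M (\<Omega> \<alpha>)) (X \<alpha>). X \<alpha> f \<le> 1}. ennreal (d / 2) < pairing \<alpha> g"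
      using indicator_block_measurable[OF \<alpha> B]
      by (simp add: koethe_dual_norm_def pairing_def less_SUP_iff)
    then obtain g where g: "g \<in> borel_measurable (restrict_space M (\<Omega> \<alpha>))" "X \<alpha> g \<le> 1"
      "ennreal (d / 2) < pairing \<alpha> g"
      by (auto simp: ideal_carrier_iff)
    have "dual_block_norm B \<alpha> = 2 * ennreal (d / 2)"
      using d by (simp add: ennreal_mult[of 2 "d / 2", simplified])
    also have "\<dots> \<le> 2 * pairing \<alpha> g"
      using g(3) by (intro mult_left_mono) auto
    finally show ?thesis using g by blast
  qed
  then obtain g where g: "\<And>\<alpha>. \<alpha> \<in> I \<Longrightarrow> g \<alpha> \<in> borel_measurable (restrict_space M (\<Omega> \<alpha>))"
    "\<And>\<alpha>. \<alpha> \<in> I \<Longrightarrow> X \<alpha> (g \<alpha>) \<le> 1" "\<And>\<alpha>. \<alpha> \<in> I \<Longrightarrow> dual_block_norm B \<alpha> \<le> 2 * pairing \<alpha> (g \<alpha>)"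
    by metis
  have "koethe_dual_norm (count_space I) E (\<lambda>\<alpha>. enn2real (dual_block_norm B \<alpha>)) \<le> 2 * ennreal C"
  proof (rule koethe_dual_norm_leI)
    fix a assume a: "E a \<le> 1"
    show "(\<integral>\<^sup>+ \<alpha>. ennreal \<bar>a \<alpha> * enn2real (dual_block_norm B \<alpha>)\<bar> \<partial>count_space I) \<le> 2 * ennreal C"
    proof (rule nn_integral_count_space_le_if_finite_sums_le[OF countable_I])
      fix F assume F: "finite F" "F \<subseteq> I"
      have "(\<Sum>\<alpha>\<in>F. ennreal \<bar>a \<alpha> * enn2real (dual_block_norm B \<alpha>)\<bar>)
          = (\<Sum>\<alpha>\<in>F. ennreal \<bar>a \<alpha>\<bar> * dual_block_norm B \<alpha>)"
        using F(2) fin by (intro sum.cong) (auto simp: abs_mult ennreal_mult)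
      also have "\<dots> \<le> (\<Sum>\<alpha>\<in>F. ennreal \<bar>a \<alpha>\<bar> * (2 * pairing \<alpha> (g \<alpha>)))"
        using F(2) g(3) by (intro sum_mono mult_left_mono) auto
      also have "\<dots> = 2 * (\<Sum>\<alpha>\<in>F. ennreal \<bar>a \<alpha>\<bar> * pairing \<alpha> (g \<alpha>))"
        by (simp add: sum_distrib_left mult.left_commute)
      also have "\<dots> \<le> 2 * (ennreal C * E a)"
        unfolding pairing_def using F g
        by (intro mult_left_mono finite_sum_le_integral_bound[OF B bound]) auto
      also have "\<dots> \<le> 2 * (ennreal C * 1)"
        using a by (intro mult_left_mono) auto
      finally show "(\<Sum>\<alpha>\<in>F. ennreal \<bar>a \<alpha> * enn2real (dual_block_norm B \<alpha>)\<bar>) \<le> 2 * ennreal C"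
        by simp
    qed
  qed simp
  also have "\<dots> < \<infinity>" by (simp add: ennreal_mult_less_top)
  finally show ?thesis using fin by (simp add: family_norm_def)
qed

lemma local_integral_bound_iff:
  assumes "B \<in> sets M"
  shows "(\<exists>C::real. 0 < C \<and>
      (\<forall>f\<in>L0_nonneg M. (\<integral>\<^sup>+ x\<in>B. ennreal (f x) \<partial>M) \<le> ennreal C * herz_norm f))
    \<longleftrightarrow> dual_herz_norm B < \<infinity>"
proof
  assume "dual_herz_norm B < \<infinity>"
  \<comment> \<open>The summand \<open>1\<close> keeps the constant positive when the dual norm vanishes.\<close>
  define C where "C = enn2real (dual_herz_norm B) + 1"
  have C: "0 < C" "dual_herz_norm B \<le> ennreal C"
  proof -
    show "0 < C" by (simp add: C_def add_nonneg_pos)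
    have "dual_herz_norm B = ennreal (enn2real (dual_herz_norm B))"
      using \<open>dual_herz_norm B < \<infinity>\<close> by simp
    also have "\<dots> \<le> ennreal C" by (intro ennreal_leI) (simp add: C_def)
    finally show "dual_herz_norm B \<le> ennreal C" .
  qed
  have "(\<integral>\<^sup>+ x\<in>B. ennreal (f x) \<partial>M) \<le> ennreal C * herz_norm f" if "f \<in> L0_nonneg M" for f
  proof (cases "herz_norm f < \<infinity>")
    case True
    have "(\<integral>\<^sup>+ x\<in>B. ennreal (f x) \<partial>M) \<le> herz_norm f * dual_herz_norm B"
      by (rule integral_le_dual_norm[OF that assms True \<open>dual_herz_norm B < \<infinity>\<close>])
    also have "\<dots> \<le> herz_norm f * ennreal C"
      using C(2) by (intro mult_left_mono) auto
    finally show ?thesis by (simp add: mult.commute)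
  next
    case False
    \<comment> \<open>The right-hand side is infinite, because \<open>C\<close> is positive.\<close>
    then show ?thesis using C(1) by (simp add: less_top[symmetric] ennreal_mult_top)
  qed
  with C(1) show "\<exists>C::real. 0 < C \<and>
      (\<forall>f\<in>L0_nonneg M. (\<integral>\<^sup>+ x\<in>B. ennreal (f x) \<partial>M) \<le> ennreal C * herz_norm f)"
    by blast
next
  assume "\<exists>C::real. 0 < C \<and>
      (\<forall>f\<in>L0_nonneg M. (\<integral>\<^sup>+ x\<in>B. ennreal (f x) \<partial>M) \<le> ennreal C * herz_norm f)"
  then show "dual_herz_norm B < \<infinity>"
    using dual_herz_norm_finite[OF assms] by blast
qed

end

theorem theorem3p18:
  fixes M :: "'a measure"
    and I :: "'i set"
    and \<Omega> :: "'i \<Rightarrow> 'a set"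
    and X :: "'i \<Rightarrow> ('a \<Rightarrow> real) \<Rightarrow> ennreal"
    and E :: "('i \<Rightarrow> real) \<Rightarrow> ennreal"
  assumes "complete_measure M"
    and "sigma_finite_measure M"
    and "countable I"
    and "measurable_partition M I \<Omega>"
    and "\<And>\<alpha>. \<alpha> \<in> I \<Longrightarrow> banach_ideal_space (restrict_space M (\<Omega> \<alpha>)) (X \<alpha>)"
    and "\<And>\<alpha>. \<alpha> \<in> I \<Longrightarrow> nontrivial_space (restrict_space M (\<Omega> \<alpha>)) (X \<alpha>)"
    and "banach_ideal_space (count_space I) E"
    and "fatou_property (count_space I) E"
    and "\<And>\<alpha>. \<alpha> \<in> I \<Longrightarrow> fatou_property (restrict_space M (\<Omega> \<alpha>)) (X \<alpha>)"
    and "order_continuous_space (count_space I) E"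
    and "order_continuous_dual (count_space I) E"
    and "\<And>\<alpha>. \<alpha> \<in> I \<Longrightarrow> order_continuous_space (restrict_space M (\<Omega> \<alpha>)) (X \<alpha>)"
  shows "banach_function_space M (koethe_herz_space M I \<Omega> X E) (koethe_herz_norm M I \<Omega> X E) \<longleftrightarrow>
    (\<forall>A \<in> sets M. emeasure M A < \<infinity> \<longrightarrow>
       family_norm I E (\<lambda>\<alpha>. X \<alpha> (indicator (\<Omega> \<alpha> \<inter> A))) < \<infinity> \<and>
       family_norm I (koethe_dual_norm (count_space I) E)
         (\<lambda>\<alpha>. koethe_dual_norm (restrict_space M (\<Omega> \<alpha>)) (X \<alpha>) (indicator (\<Omega> \<alpha> \<inter> A))) < \<infinity>)"
proof -
  interpret koethe_herz M I \<Omega> X E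
    by unfold_locales (use assms in auto)
  show ?thesis
    unfolding banach_function_space_iff using local_integral_bound_iff by auto
qed

end
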